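(* For a topological space $S$, the space $(Y_{\mathcal{O}S},\tau)$ is homeomorphic to the soberification of $S$.
   Context: $\mathcal{O}S$ denotes the frame of open sets of $S$. For a frame $L$ (complete lattice with $a\wedge\bigvee S=\bigvee\{a\wedge s\mid s\in S\}$), $\mathsf{pt}(L)$ is the space of points of $L$, viewed as completely prime filters of $L$, with open sets $\eta(a)=\{x\in\mathsf{pt}(L)\mid a\in x\}$, $a\in L$. The soberification of $S$ is the space $\mathsf{pt}(\mathcal{O}S)$. The Esakia space $X_L$ of a frame $L$ is the set of prime (proper) filters of $L$, ordered by inclusion, with the topology $\pi$ whose basis is $\{\varphi(a)\setminus\varphi(b)\mid a,b\in L\}$, where $\varphi(a)=\{x\in X_L\mid a\in x\}$. For $S\subseteq X_L$, ${\downarrow}S=\{x\mid x\le s\text{ for some }s\in S\}$; upsets are sets closed upward under $\le$. A closed subset $F$ of $X_L$ is nuclear if ${\downarrow}(U\cap F)$ is clopen for each clopen $U\subseteq X_L$. $Y_L$ is the set of nuclear points of $X_L$, i.e. of $y\in X_L$ such that $\{y\}$ is nuclear. $\tau$ is the subspace topology on $Y_L$ induced by the topology of $\pi$-open upsets of $X_L$. Here $L=\mathcal{O}S$. *)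

theory Defs
  imports "HOL-Analysis.Abstract_Topology" "HOL-Algebra.Complete_Lattice"
begin

section \<open>Frames and their filters\<close>

locale frame = complete_lattice L for L (structure) +
  assumes meet_sup_distrib:
    "\<lbrakk>a \<in> carrier L; A \<subseteq> carrier L\<rbrakk> \<Longrightarrow> a \<sqinter> \<Squnion>A = \<Squnion>((\<lambda>s. a \<sqinter> s) ` A)"

definition opens_frame :: "'a topology \<Rightarrow> 'a set gorder" where
  "opens_frame S = \<lparr>carrier = {U. openin S U}, eq = (=), le = (\<subseteq>)\<rparr>"

definition lattice_filter :: "('a, 'b) gorder_scheme \<Rightarrow> 'a set \<Rightarrow> bool" where
  "lattice_filter L F \<longleftrightarrow>
     F \<subseteq> carrier L \<and> F \<noteq> {} \<and>
     (\<forall>a\<in>F. \<forall>b\<in>carrier L. a \<sqsubseteq>\<^bsub>L\<^esub> b \<longrightarrow> b \<in> F) \<and>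
     (\<forall>a\<in>F. \<forall>b\<in>F. a \<sqinter>\<^bsub>L\<^esub> b \<in> F)"

definition prime_filter :: "('a, 'b) gorder_scheme \<Rightarrow> 'a set \<Rightarrow> bool" where
  "prime_filter L F \<longleftrightarrow>
     lattice_filter L F \<and> F \<noteq> carrier L \<and>
     (\<forall>a\<in>carrier L. \<forall>b\<in>carrier L. a \<squnion>\<^bsub>L\<^esub> b \<in> F \<longrightarrow> a \<in> F \<or> b \<in> F)"

text \<open>Taking \<open>A = {}\<close> shows that a completely prime filter omits the bottom element, so it
  is automatically proper.\<close>

definition completely_prime_filter :: "('a, 'b) gorder_scheme \<Rightarrow> 'a set \<Rightarrow> bool" where
  "completely_prime_filter L F \<longleftrightarrow>
     lattice_filter L F \<and>
     (\<forall>A. A \<subseteq> carrier L \<longrightarrow> \<Squnion>\<^bsub>L\<^esub>A \<in> F \<longrightarrow> (\<exists>a\<in>A. a \<in> F))"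


section \<open>The space of points and the soberification\<close>

definition eta :: "('a, 'b) gorder_scheme \<Rightarrow> 'a \<Rightarrow> 'a set set" where
  "eta L a = {x. completely_prime_filter L x \<and> a \<in> x}"

definition pt_space :: "('a, 'b) gorder_scheme \<Rightarrow> 'a set topology" where
  "pt_space L = topology (\<lambda>V. \<exists>a\<in>carrier L. V = eta L a)"

definition soberification :: "'a topology \<Rightarrow> 'a set set topology" where
  "soberification S = pt_space (opens_frame S)"


section \<open>The Esakia space of a frame and its nuclear points\<close>

definition phi :: "('a, 'b) gorder_scheme \<Rightarrow> 'a \<Rightarrow> 'a set set" where
  "phi L a = {x. prime_filter L x \<and> a \<in> x}"

definition esakia_space :: "('a, 'b) gorder_scheme \<Rightarrow> 'a set topology" where
  "esakia_space L =
     topology (arbitrary union_of (\<lambda>W. \<exists>a\<in>carrier L. \<exists>b\<in>carrier L. W = phi L a - phi L b))"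

definition down_closure :: "('a, 'b) gorder_scheme \<Rightarrow> 'a set set \<Rightarrow> 'a set set" where
  "down_closure L T = {x. prime_filter L x \<and> (\<exists>s\<in>T. x \<subseteq> s)}"

definition upset :: "('a, 'b) gorder_scheme \<Rightarrow> 'a set set \<Rightarrow> bool" where
  "upset L U \<longleftrightarrow>
     U \<subseteq> {x. prime_filter L x} \<and> (\<forall>x\<in>U. \<forall>y. prime_filter L y \<and> x \<subseteq> y \<longrightarrow> y \<in> U)"

definition clopen_in :: "'a topology \<Rightarrow> 'a set \<Rightarrow> bool" where
  "clopen_in X U \<longleftrightarrow> openin X U \<and> closedin X U"

definition nuclear :: "('a, 'b) gorder_scheme \<Rightarrow> 'a set set \<Rightarrow> bool" where
  "nuclear L F \<longleftrightarrow>
     closedin (esakia_space L) F \<and>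
     (\<forall>U. clopen_in (esakia_space L) U \<longrightarrow>
          clopen_in (esakia_space L) (down_closure L (U \<inter> F)))"

definition nuclear_points :: "('a, 'b) gorder_scheme \<Rightarrow> 'a set set" where
  "nuclear_points L = {y. prime_filter L y \<and> nuclear L {y}}"

definition open_upset_topology :: "('a, 'b) gorder_scheme \<Rightarrow> 'a set topology" where
  "open_upset_topology L = topology (\<lambda>U. openin (esakia_space L) U \<and> upset L U)"

definition nuclear_point_space :: "('a, 'b) gorder_scheme \<Rightarrow> 'a set topology" where
  "nuclear_point_space L = subtopology (open_upset_topology L) (nuclear_points L)"


section \<open>The definitions by \<^const>\<open>topology\<close> describe topologies\<close>

lemma carrier_opens_frame [simp]: "carrier (opens_frame S) = {U. openin S U}"
  and le_opens_frame [simp]: "U \<sqsubseteq>\<^bsub>opens_frame S\<^esub> V \<longleftrightarrow> U \<subseteq> V"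
  by (simp_all add: opens_frame_def)

lemma complete_lattice_opens_frame: "complete_lattice (opens_frame S)"
proof (rule partial_order.complete_latticeI)
  show "partial_order (opens_frame S)"
    by standard (auto simp: opens_frame_def)
next
  fix A assume A: "A \<subseteq> carrier (opens_frame S)"
  then have "least (opens_frame S) (\<Union>A) (Upper (opens_frame S) A)"
    by (auto simp: least_def Upper_def opens_frame_def)
  then show "\<exists>s. least (opens_frame S) s (Upper (opens_frame S) A)" ..
next
  fix A assume A: "A \<subseteq> carrier (opens_frame S)"
  let ?I = "\<Union>{U. openin S U \<and> (\<forall>V\<in>A. U \<subseteq> V)}"
  have "greatest (opens_frame S) ?I (Lower (opens_frame S) A)"
    using A by (auto simp: greatest_def Lower_def opens_frame_def)
  then show "\<exists>i. greatest (opens_frame S) i (Lower (opens_frame S) A)" ..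
qed

lemma sup_opens_frame:
  assumes "A \<subseteq> {U. openin S U}"
  shows "\<Squnion>\<^bsub>opens_frame S\<^esub>A = \<Union>A"
proof -
  interpret complete_lattice "opens_frame S" by (rule complete_lattice_opens_frame)
  have "\<Squnion>\<^bsub>opens_frame S\<^esub>A \<subseteq> \<Union>A"
    using sup_least[of A "\<Union>A"] assms by auto
  moreover have "\<Union>A \<subseteq> \<Squnion>\<^bsub>opens_frame S\<^esub>A"
    using sup_upper[of A] assms by auto
  ultimately show ?thesis by blast
qed

lemma join_opens_frame:
  "openin S U \<Longrightarrow> openin S V \<Longrightarrow> U \<squnion>\<^bsub>opens_frame S\<^esub> V = U \<union> V"
  by (simp add: join_def sup_opens_frame)

lemma meet_opens_frame:
  assumes "openin S U" "openin S V"
  shows "U \<sqinter>\<^bsub>opens_frame S\<^esub> V = U \<inter> V"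
proof -
  interpret complete_lattice "opens_frame S" by (rule complete_lattice_opens_frame)
  have "U \<sqinter>\<^bsub>opens_frame S\<^esub> V \<subseteq> U \<inter> V"
    using meet_left[of U V] meet_right[of U V] assms by simp
  moreover have "U \<inter> V \<subseteq> U \<sqinter>\<^bsub>opens_frame S\<^esub> V"
    using meet_le[of "U \<inter> V" U V] assms by auto
  ultimately show ?thesis by blast
qed

lemma frame_opens_frame: "frame (opens_frame S)"
proof -
  interpret complete_lattice "opens_frame S" by (rule complete_lattice_opens_frame)
  show ?thesis
  proof
    fix U A assume U: "U \<in> carrier (opens_frame S)" and A: "A \<subseteq> carrier (opens_frame S)"
    have im: "(\<lambda>V. U \<sqinter>\<^bsub>opens_frame S\<^esub> V) ` A = (\<lambda>V. U \<inter> V) ` A"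
    proof (rule image_cong[OF HOL.refl])
      fix V assume "V \<in> A"
      then show "U \<sqinter>\<^bsub>opens_frame S\<^esub> V = U \<inter> V"
        using U A by (intro meet_opens_frame) auto
    qed
    have "\<Squnion>\<^bsub>opens_frame S\<^esub>((\<lambda>V. U \<inter> V) ` A) = \<Union>((\<lambda>V. U \<inter> V) ` A)"
      using U A by (intro sup_opens_frame) auto
    moreover have "U \<sqinter>\<^bsub>opens_frame S\<^esub> \<Squnion>\<^bsub>opens_frame S\<^esub>A = U \<inter> \<Union>A"
      using U A by (subst sup_opens_frame) (auto intro!: meet_opens_frame)
    ultimately show "U \<sqinter>\<^bsub>opens_frame S\<^esub> \<Squnion>\<^bsub>opens_frame S\<^esub>A
        = \<Squnion>\<^bsub>opens_frame S\<^esub>((\<lambda>V. U \<sqinter>\<^bsub>opens_frame S\<^esub> V) ` A)"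
      using im by simp
  qed
qed

context complete_lattice
begin

lemma filter_meet_iff:
  assumes "lattice_filter L x" "a \<in> carrier L" "b \<in> carrier L"
  shows "a \<sqinter> b \<in> x \<longleftrightarrow> a \<in> x \<and> b \<in> x"
proof -
  have up: "d \<in> x" if "c \<in> x" "d \<in> carrier L" "c \<sqsubseteq> d" for c d
    using assms(1) that by (simp add: lattice_filter_def)
  have "a \<sqinter> b \<in> x" if "a \<in> x" "b \<in> x"
    using assms(1) that by (simp add: lattice_filter_def)
  then show ?thesis
    using up[OF _ assms(2) meet_left[OF assms(2,3)]] up[OF _ assms(3) meet_right[OF assms(2,3)]]
    by metis
qed

lemma prime_filter_join_iff:
  assumes "prime_filter L x" "a \<in> carrier L" "b \<in> carrier L"
  shows "a \<squnion> b \<in> x \<longleftrightarrow> a \<in> x \<or> b \<in> x"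
proof -
  have up: "d \<in> x" if "c \<in> x" "d \<in> carrier L" "c \<sqsubseteq> d" for c d
    using assms(1) that by (simp add: prime_filter_def lattice_filter_def)
  have "a \<in> x \<or> b \<in> x" if "a \<squnion> b \<in> x"
    using assms that by (simp add: prime_filter_def)
  then show ?thesis
    using up[OF _ join_closed[OF assms(2,3)] join_left[OF assms(2,3)]]
      up[OF _ join_closed[OF assms(2,3)] join_right[OF assms(2,3)]]
    by metis
qed

lemma completely_prime_filter_sup_iff:
  assumes "completely_prime_filter L x" "A \<subseteq> carrier L"
  shows "\<Squnion>A \<in> x \<longleftrightarrow> (\<exists>a\<in>A. a \<in> x)"
proof
  show "\<exists>a\<in>A. a \<in> x" if "\<Squnion>A \<in> x"
    using assms that by (simp add: completely_prime_filter_def)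
next
  assume "\<exists>a\<in>A. a \<in> x"
  then obtain a where a: "a \<in> A" "a \<in> x" by (elim bexE)
  have "a \<sqsubseteq> \<Squnion>A" by (rule sup_upper[OF assms(2) a(1)])
  then show "\<Squnion>A \<in> x"
    using assms(1) a(2) sup_closed[OF assms(2)]
    by (simp add: completely_prime_filter_def lattice_filter_def)
qed

lemma openin_pt_space: "openin (pt_space L) V \<longleftrightarrow> (\<exists>a\<in>carrier L. V = eta L a)"
proof -
  have "istopology (\<lambda>V. \<exists>a\<in>carrier L. V = eta L a)"
    unfolding istopology_def
  proof (intro conjI allI impI)
    fix V W assume "\<exists>a\<in>carrier L. V = eta L a" "\<exists>a\<in>carrier L. W = eta L a"
    then obtain a b where ab: "a \<in> carrier L" "b \<in> carrier L" "V = eta L a" "W = eta L b"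
      by blast
    then have "V \<inter> W = eta L (a \<sqinter> b)"
      using filter_meet_iff[OF _ ab(1,2)] by (auto simp: eta_def completely_prime_filter_def)
    then show "\<exists>c\<in>carrier L. V \<inter> W = eta L c"
      using ab meet_closed by blast
  next
    fix K assume K: "\<forall>V\<in>K. \<exists>a\<in>carrier L. V = eta L a"
    define A where "A = {a \<in> carrier L. eta L a \<in> K}"
    have A: "A \<subseteq> carrier L" by (auto simp: A_def)
    have "\<Union>K = (\<Union>a\<in>A. eta L a)" using K by (auto simp: A_def)
    also have "\<dots> = eta L (\<Squnion>A)"
      using completely_prime_filter_sup_iff[OF _ A] by (auto simp: eta_def)
    finally show "\<exists>c\<in>carrier L. \<Union>K = eta L c" using sup_closed[OF A] by blast
  qed
  then show ?thesis by (simp add: pt_space_def)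
qed

lemma openin_esakia_space:
  "openin (esakia_space L) =
     arbitrary union_of (\<lambda>W. \<exists>a\<in>carrier L. \<exists>b\<in>carrier L. W = phi L a - phi L b)"
proof -
  have "istopology (arbitrary union_of
          (\<lambda>W. \<exists>a\<in>carrier L. \<exists>b\<in>carrier L. W = phi L a - phi L b))"
  proof (rule istopology_base)
    fix V W
    assume "\<exists>a\<in>carrier L. \<exists>b\<in>carrier L. V = phi L a - phi L b"
      and "\<exists>a\<in>carrier L. \<exists>b\<in>carrier L. W = phi L a - phi L b"
    then obtain a b c d where *: "a \<in> carrier L" "b \<in> carrier L" "c \<in> carrier L" "d \<in> carrier L"
        "V = phi L a - phi L b" "W = phi L c - phi L d"
      by blast
    have "V \<inter> W = phi L (a \<sqinter> c) - phi L (b \<squnion> d)"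
      using filter_meet_iff[OF _ *(1,3)] prime_filter_join_iff[OF _ *(2,4)]
      by (auto simp: *(5,6) phi_def prime_filter_def)
    then show "\<exists>a\<in>carrier L. \<exists>b\<in>carrier L. V \<inter> W = phi L a - phi L b"
      using * meet_closed join_closed by blast
  qed
  then show ?thesis by (simp add: esakia_space_def)
qed

lemma topspace_esakia_space: "topspace (esakia_space L) = {x. prime_filter L x}"
proof -
  have "x \<in> phi L \<top> - phi L \<bottom>" if "prime_filter L x" for x
  proof -
    have lf: "lattice_filter L x" and ne: "x \<noteq> carrier L"
      using that by (auto simp: prime_filter_def)
    obtain a where "a \<in> x" "a \<in> carrier L"
      using lf unfolding lattice_filter_def by blast
    then have "\<top> \<in> x"
      using lf top_closed top_higher[of a] by (simp add: lattice_filter_def)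
    moreover have "\<bottom> \<notin> x"
    proof
      assume "\<bottom> \<in> x"
      then have "carrier L \<subseteq> x" using lf bottom_lower by (auto simp: lattice_filter_def)
      then show False using lf ne by (auto simp: lattice_filter_def)
    qed
    ultimately show ?thesis using that by (auto simp: phi_def)
  qed
  moreover have "openin (esakia_space L) (phi L \<top> - phi L \<bottom>)"
    unfolding openin_esakia_space
    by (rule arbitrary_union_of_inc) (use top_closed bottom_closed in blast)
  ultimately have "{x. prime_filter L x} \<subseteq> topspace (esakia_space L)"
    using openin_subset by fastforce
  moreover have "topspace (esakia_space L) \<subseteq> {x. prime_filter L x}"
    unfolding topspace_def openin_esakia_space by (auto simp: union_of_def phi_def)
  ultimately show ?thesis by blast
qed

end

lemma openin_open_upset_topology:
  "openin (open_upset_topology L) U \<longleftrightarrow> openin (esakia_space L) U \<and> upset L U"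
proof -
  have "istopology (\<lambda>U. openin (esakia_space L) U \<and> upset L U)"
    unfolding istopology_def
  proof (intro conjI allI impI)
    fix U V
    assume "openin (esakia_space L) U \<and> upset L U" "openin (esakia_space L) V \<and> upset L V"
    then show "openin (esakia_space L) (U \<inter> V)" "upset L (U \<inter> V)"
      by (auto simp: upset_def)
  next
    fix K
    assume K: "\<forall>U\<in>K. openin (esakia_space L) U \<and> upset L U"
    then show "openin (esakia_space L) (\<Union>K)" by (simp add: openin_Union)
    show "upset L (\<Union>K)"
      unfolding upset_def
    proof (intro conjI ballI allI impI)
      show "\<Union>K \<subseteq> {x. prime_filter L x}"
        using K by (auto simp: upset_def)
    next
      fix x y assume "x \<in> \<Union>K" and y: "prime_filter L y \<and> x \<subseteq> y"
      then obtain U where "U \<in> K" "x \<in> U" by blast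
      with K y have "y \<in> U" unfolding upset_def by blast
      with \<open>U \<in> K\<close> show "y \<in> \<Union>K" by blast
    qed
  qed
  then show ?thesis by (simp add: open_upset_topology_def)
qed

end

theory Submission
  imports Defs
begin

text \<open>The two spaces are literally equal, for every frame \<open>L\<close>. If \<open>y\<close> is completely prime and
  \<open>m\<close> is the join of all elements outside \<open>y\<close>, then the down-closure of \<open>{y}\<close> is the complement
  of \<open>\<phi>(m)\<close>. Conversely, if the down-closure of \<open>{y}\<close> is open, it contains some
  \<open>\<phi>(c) - \<phi>(d)\<close> around \<open>y\<close>; the prime filter theorem then gives \<open>c \<sqinter> b \<sqsubseteq> d\<close> for all
  \<open>b \<notin> y\<close>, and the frame law carries this bound over to joins of such \<open>b\<close>. Every open upset
  is a union of sets \<open>\<phi>(a)\<close> by a compactness argument, and on completely prime filters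
  the union of the \<open>\<phi>(a)\<close> is given by the join of the \<open>a\<close>.\<close>

section \<open>Filters of a complete lattice\<close>

lemma lattice_filter_upward:
  assumes "lattice_filter L x" "a \<in> x" "b \<in> carrier L" "a \<sqsubseteq>\<^bsub>L\<^esub> b"
  shows "b \<in> x"
  using assms by (simp add: lattice_filter_def)

lemma lattice_filter_carrier: "lattice_filter L x \<Longrightarrow> a \<in> x \<Longrightarrow> a \<in> carrier L"
  by (auto simp: lattice_filter_def)

lemma lattice_filter_meet:
  "lattice_filter L x \<Longrightarrow> a \<in> x \<Longrightarrow> b \<in> x \<Longrightarrow> a \<sqinter>\<^bsub>L\<^esub> b \<in> x"
  by (simp add: lattice_filter_def)

lemma prime_filter_lattice_filter: "prime_filter L x \<Longrightarrow> lattice_filter L x"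
  by (simp add: prime_filter_def)

text \<open>Supplies the upper bounds for Zorn's lemma in \<open>prime_filter_extension\<close>.
  Meets cause no trouble, because any two elements of the union already lie in one member of the
  chain.\<close>

lemma lattice_filter_Union_chain:
  assumes ne: "C \<noteq> {}" and C: "\<And>x. x \<in> C \<Longrightarrow> lattice_filter L x"
    and chain: "\<And>x y. x \<in> C \<Longrightarrow> y \<in> C \<Longrightarrow> x \<subseteq> y \<or> y \<subseteq> x"
  shows "lattice_filter L (\<Union>C)"
  unfolding lattice_filter_def
proof (intro conjI ballI impI)
  show "\<Union>C \<subseteq> carrier L" using C lattice_filter_carrier by fast
  show "\<Union>C \<noteq> {}" using ne C by (fastforce simp: lattice_filter_def)
next
  fix a b assume "a \<in> \<Union>C" "b \<in> carrier L" "a \<sqsubseteq>\<^bsub>L\<^esub> b"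
  then show "b \<in> \<Union>C" using C lattice_filter_upward by (metis UnionE UnionI)
next
  fix a b assume "a \<in> \<Union>C" "b \<in> \<Union>C"
  then obtain x where "x \<in> C" "a \<in> x" "b \<in> x" using chain by blast
  then show "a \<sqinter>\<^bsub>L\<^esub> b \<in> \<Union>C" using C lattice_filter_meet by (metis UnionI)
qed

context complete_lattice
begin

lemma meet_left_mono:
  assumes "a \<sqsubseteq> c" "a \<in> carrier L" "b \<in> carrier L" "c \<in> carrier L"
  shows "a \<sqinter> b \<sqsubseteq> c \<sqinter> b"
proof (rule meet_le)
  show "a \<sqinter> b \<sqsubseteq> c" by (rule le_trans[OF meet_left]) (use assms in auto)
qed (use assms in \<open>auto intro: meet_right\<close>)

lemma lattice_filter_top: "lattice_filter L x \<Longrightarrow> \<top> \<in> x"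
  using lattice_filter_upward[of L x _ \<top>] lattice_filter_carrier[of L x] top_closed top_higher
  unfolding lattice_filter_def by blast

lemma prime_filter_bottom:
  assumes "prime_filter L x"
  shows "\<bottom> \<notin> x"
proof
  assume "\<bottom> \<in> x"
  then have "carrier L \<subseteq> x"
    using assms bottom_lower by (auto simp: prime_filter_def lattice_filter_def)
  then show False using assms by (auto simp: prime_filter_def lattice_filter_def)
qed

text \<open>The empty join gives an element outside \<open>x\<close>, hence properness; the join of
  \<open>{a, b}\<close> gives primeness.\<close>

lemma completely_prime_filter_prime:
  assumes "completely_prime_filter L x"
  shows "prime_filter L x"
proof -
  have lf: "lattice_filter L x" using assms by (simp add: completely_prime_filter_def)
  have "\<Squnion>{} \<notin> x" using assms unfolding completely_prime_filter_def by blast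
  moreover have "\<Squnion>{} \<in> carrier L" by (rule sup_closed) simp
  moreover have "a \<in> x \<or> b \<in> x" if "a \<in> carrier L" "b \<in> carrier L" "a \<squnion> b \<in> x" for a b
    using completely_prime_filter_sup_iff[OF assms, of "{a, b}"] that by (auto simp: join_def)
  ultimately show ?thesis using lf unfolding prime_filter_def by blast
qed

text \<open>\<open>x'\<close> is the filter generated by \<open>x\<close> and \<open>d\<close>. It
  is the competitor against which a maximal filter is tested in
  \<open>prime_filter_extension\<close>.\<close>

lemma lattice_filter_adjoin:
  assumes x: "lattice_filter L x" and d: "d \<in> carrier L"
  defines "x' \<equiv> {e \<in> carrier L. \<exists>c\<in>x. c \<sqinter> d \<sqsubseteq> e}"
  shows "lattice_filter L x'" "x \<subseteq> x'" "d \<in> x'"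
proof -
  note car = lattice_filter_carrier[OF x]
  show sub: "x \<subseteq> x'"
    unfolding x'_def using car d meet_left by blast
  show "d \<in> x'"
    unfolding x'_def using d car meet_right lattice_filter_top[OF x] by blast
  show "lattice_filter L x'"
    unfolding lattice_filter_def
  proof (intro conjI ballI impI)
    show "x' \<subseteq> carrier L" by (auto simp: x'_def)
    show "x' \<noteq> {}" using \<open>d \<in> x'\<close> by blast
  next
    fix a b assume a: "a \<in> x'" and b: "b \<in> carrier L" "a \<sqsubseteq> b"
    then obtain c where "c \<in> x" "c \<sqinter> d \<sqsubseteq> a" "a \<in> carrier L" by (auto simp: x'_def)
    then show "b \<in> x'"
      unfolding x'_def using b le_trans[of "c \<sqinter> d" a b] car d meet_closed by blast
  next
    fix a b assume "a \<in> x'" "b \<in> x'"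
    then obtain c c' where *: "c \<in> x" "c \<sqinter> d \<sqsubseteq> a" "a \<in> carrier L"
        "c' \<in> x" "c' \<sqinter> d \<sqsubseteq> b" "b \<in> carrier L"
      by (auto simp: x'_def)
    \<comment> \<open>The meet of the two witnesses serves for \<open>a\<close> and \<open>b\<close>
      at once.\<close>
    have cc: "c \<sqinter> c' \<in> x" using * lattice_filter_meet[OF x] by blast
    note cl = car[OF *(1)] car[OF *(4)] car[OF cc]
    have m: "(c \<sqinter> c') \<sqinter> d \<in> carrier L" by (rule meet_closed; fact cl d)
    have cm: "c \<sqinter> c' \<sqsubseteq> c" "c \<sqinter> c' \<sqsubseteq> c'" by (rule meet_left meet_right; fact cl)+
    have "(c \<sqinter> c') \<sqinter> d \<sqsubseteq> c \<sqinter> d" by (rule meet_left_mono[OF cm(1)]; fact cl d)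
    then have ma: "(c \<sqinter> c') \<sqinter> d \<sqsubseteq> a" by (rule le_trans[OF _ *(2) m _ *(3)]) (rule meet_closed; fact cl d)
    have "(c \<sqinter> c') \<sqinter> d \<sqsubseteq> c' \<sqinter> d" by (rule meet_left_mono[OF cm(2)]; fact cl d)
    then have mb: "(c \<sqinter> c') \<sqinter> d \<sqsubseteq> b" by (rule le_trans[OF _ *(5) m _ *(6)]) (rule meet_closed; fact cl d)
    have "(c \<sqinter> c') \<sqinter> d \<sqsubseteq> a \<sqinter> b" by (rule meet_le[OF ma mb *(3) *(6) m])
    then show "a \<sqinter> b \<in> x'" unfolding x'_def using cc * meet_closed by blast
  qed
qed

section \<open>Open and closed sets of the Esakia space\<close>

lemma phi_diff_open:
  "a \<in> carrier L \<Longrightarrow> b \<in> carrier L \<Longrightarrow> openin (esakia_space L) (phi L a - phi L b)"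
  unfolding openin_esakia_space by (rule arbitrary_union_of_inc) blast

lemma phi_open: "a \<in> carrier L \<Longrightarrow> openin (esakia_space L) (phi L a)"
proof -
  assume "a \<in> carrier L"
  moreover have "phi L \<bottom> = {}" using prime_filter_bottom by (auto simp: phi_def)
  ultimately show ?thesis using phi_diff_open[of a \<bottom>] bottom_closed by simp
qed

lemma phi_compl_open:
  assumes "a \<in> carrier L"
  shows "openin (esakia_space L) (topspace (esakia_space L) - phi L a)"
proof -
  have "phi L \<top> = topspace (esakia_space L)"
    by (auto simp: topspace_esakia_space phi_def
        intro: lattice_filter_top prime_filter_lattice_filter)
  then show ?thesis by (metis phi_diff_open assms top_closed)
qed

lemma openin_esakia_spaceE:
  assumes "openin (esakia_space L) U" "x \<in> U"
  obtains c d where "c \<in> carrier L" "d \<in> carrier L" "x \<in> phi L c - phi L d"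
    "phi L c - phi L d \<subseteq> U"
  using assms unfolding openin_esakia_space union_of_def by blast

text \<open>Any other prime filter differs from \<open>y\<close> at some element \<open>a\<close>,
  and both \<open>phi L a\<close> and its complement are open.\<close>

lemma closedin_esakia_space_singleton:
  assumes "prime_filter L y"
  shows "closedin (esakia_space L) {y}"
proof -
  let ?X = "topspace (esakia_space L)"
  have car: "a \<in> carrier L" if "prime_filter L x" "a \<in> x" for x a
    using that lattice_filter_carrier prime_filter_lattice_filter by metis
  have "?X - {y} = \<Union>((phi L ` (carrier L - y)) \<union> ((\<lambda>a. ?X - phi L a) ` y))" (is "_ = ?r")
  proof (intro equalityI subsetI)
    fix x assume "x \<in> ?X - {y}"
    then have x: "prime_filter L x" "x \<noteq> y" by (auto simp: topspace_esakia_space)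
    then consider a where "a \<in> x" "a \<notin> y" | a where "a \<in> y" "a \<notin> x" by blast
    then show "x \<in> ?r"
      using x(1) car[OF x(1)] by cases (auto simp: topspace_esakia_space phi_def)
  qed (use assms in \<open>auto simp: topspace_esakia_space phi_def\<close>)
  moreover have "openin (esakia_space L) ?r"
    using phi_open phi_compl_open car[OF assms] by (intro openin_Union) auto
  ultimately show ?thesis
    using assms by (simp add: closedin_def topspace_esakia_space)
qed

section \<open>Completely prime filters are nuclear points\<close>

lemma down_closure_completely_prime:
  assumes y: "completely_prime_filter L y"
  defines "m \<equiv> \<Squnion>(carrier L - y)"
  shows "down_closure L {y} = topspace (esakia_space L) - phi L m"
proof -
  have mc: "m \<in> carrier L" unfolding m_def by (rule sup_closed) blast
  \<comment> \<open>Complete primeness enters here: a join of elements outside \<open>y\<close>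
    stays outside \<open>y\<close>.\<close>
  have my: "m \<notin> y"
    using completely_prime_filter_sup_iff[OF y, of "carrier L - y"] by (auto simp: m_def)
  have "x \<subseteq> y \<longleftrightarrow> m \<notin> x" if x: "prime_filter L x" for x
  proof
    assume m: "m \<notin> x"
    show "x \<subseteq> y"
    proof
      fix b assume b: "b \<in> x"
      note lf = prime_filter_lattice_filter[OF x]
      show "b \<in> y"
      proof (rule ccontr)
        assume "b \<notin> y"
        then have "b \<sqsubseteq> m"
          unfolding m_def using lattice_filter_carrier[OF lf b] by (intro sup_upper) auto
        then show False using lattice_filter_upward[OF lf b mc] m by blast
      qed
    qed
  qed (use my in blast)
  then show ?thesis
    unfolding down_closure_def topspace_esakia_space phi_def by blast
qed

text \<open>A set \<open>U\<close> meets \<open>{y}\<close> in \<open>{y}\<close> or in nothing, so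
  only the down-closure of \<open>{y}\<close> matters, and this is the complement of the clopen set
  \<open>phi L ?m\<close>.\<close>

lemma completely_prime_nuclear:
  assumes y: "completely_prime_filter L y"
  shows "nuclear L {y}"
  unfolding nuclear_def
proof (intro conjI allI impI)
  show "closedin (esakia_space L) {y}"
    using closedin_esakia_space_singleton completely_prime_filter_prime[OF y] by blast
next
  fix U
  let ?m = "\<Squnion>(carrier L - y)"
  have m: "?m \<in> carrier L" by (rule sup_closed) blast
  have "phi L ?m \<subseteq> topspace (esakia_space L)"
    by (auto simp: phi_def topspace_esakia_space)
  then have "clopen_in (esakia_space L) (down_closure L {y})"
    unfolding clopen_in_def down_closure_completely_prime[OF y]
    using phi_compl_open[OF m] phi_open[OF m] by (simp add: openin_diff closedin_diff)
  moreover have "clopen_in (esakia_space L) (down_closure L {})"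
    by (simp add: clopen_in_def down_closure_def)
  ultimately show "clopen_in (esakia_space L) (down_closure L (U \<inter> {y}))"
    by (cases "y \<in> U") simp_all
qed

end

section \<open>Prime filters in a frame\<close>

context frame
begin

lemma meet_join_distrib:
  assumes "a \<in> carrier L" "b \<in> carrier L" "c \<in> carrier L"
  shows "a \<sqinter> (b \<squnion> c) = (a \<sqinter> b) \<squnion> (a \<sqinter> c)"
  using meet_sup_distrib[of a "{b, c}"] assms by (simp add: join_def)

text \<open>Zorn's lemma gives a filter maximal among those that contain \<open>x0\<close> and avoid
  the ideal \<open>I\<close>; distributivity makes it prime. The last clause retains maximality:
  adjoining any element outside \<open>x\<close> produces a filter that meets
  \<open>I\<close>.\<close>

lemma prime_filter_extension:
  assumes x0: "lattice_filter L x0" and disj: "x0 \<inter> I = {}"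
    and I: "I \<subseteq> carrier L" "I \<noteq> {}"
    and down: "\<And>a b. a \<in> I \<Longrightarrow> b \<in> carrier L \<Longrightarrow> b \<sqsubseteq> a \<Longrightarrow> b \<in> I"
    and join: "\<And>a b. a \<in> I \<Longrightarrow> b \<in> I \<Longrightarrow> a \<squnion> b \<in> I"
  obtains x where "prime_filter L x" "x0 \<subseteq> x" "x \<inter> I = {}"
    "\<forall>d\<in>carrier L - x. \<exists>c\<in>x. c \<sqinter> d \<in> I"
proof -
  define \<A> where "\<A> = {x. lattice_filter L x \<and> x0 \<subseteq> x \<and> x \<inter> I = {}}"
  have "\<exists>M\<in>\<A>. \<forall>X\<in>\<A>. M \<subseteq> X \<longrightarrow> X = M"
  proof (rule subset_Zorn_nonempty)
    show "\<A> \<noteq> {}" using x0 disj by (auto simp: \<A>_def)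
  next
    fix C assume C: "C \<noteq> {}" "subset.chain \<A> C"
    then have "lattice_filter L (\<Union>C)"
      by (intro lattice_filter_Union_chain) (auto simp: \<A>_def subset_chain_def)
    then show "\<Union>C \<in> \<A>" using C by (fastforce simp: \<A>_def subset_chain_def)
  qed
  then obtain x where x: "lattice_filter L x" "x0 \<subseteq> x" "x \<inter> I = {}"
    and max: "\<And>z. z \<in> \<A> \<Longrightarrow> x \<subseteq> z \<Longrightarrow> z = x"
    by (auto simp: \<A>_def)
  note car = lattice_filter_carrier[OF x(1)]
  have ex: "\<exists>c\<in>x. c \<sqinter> d \<in> I" if d: "d \<in> carrier L" "d \<notin> x" for d
  proof -
    let ?x' = "{e \<in> carrier L. \<exists>c\<in>x. c \<sqinter> d \<sqsubseteq> e}"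
    note x' = lattice_filter_adjoin[OF x(1) d(1)]
    have "?x' \<notin> \<A>" using max[of ?x'] x'(2,3) d(2) by blast
    then obtain e where "e \<in> I" "e \<in> ?x'" using x' x(2) unfolding \<A>_def by blast
    then obtain c where "c \<in> x" "c \<sqinter> d \<sqsubseteq> e" by blast
    then show ?thesis using down[OF \<open>e \<in> I\<close>] car d(1) meet_closed by blast
  qed
  have "a \<in> x \<or> b \<in> x" if ab: "a \<in> carrier L" "b \<in> carrier L" "a \<squnion> b \<in> x" for a b
  proof (rule ccontr)
    assume "\<not> (a \<in> x \<or> b \<in> x)"
    then obtain c c' where c: "c \<in> x" "c \<sqinter> a \<in> I" "c' \<in> x" "c' \<sqinter> b \<in> I"
      using ex ab by blast
    \<comment> \<open>With a common \<open>e\<close> in place of \<open>c\<close> and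
      \<open>c'\<close>, distributivity puts the meet of \<open>e\<close> and the join of
      \<open>a\<close> and \<open>b\<close> into \<open>I\<close>, although it belongs to
      \<open>x\<close>.\<close>
    define e where "e = c \<sqinter> c'"
    have e: "e \<in> x" using c lattice_filter_meet[OF x(1)] by (simp add: e_def)
    note cl = car[OF c(1)] car[OF c(3)] car[OF e]
    have ec: "e \<sqsubseteq> c" "e \<sqsubseteq> c'" unfolding e_def by (rule meet_left meet_right; fact cl)+
    have ea: "e \<sqinter> a \<sqsubseteq> c \<sqinter> a" by (rule meet_left_mono[OF ec(1)]; fact ab cl)
    have eb: "e \<sqinter> b \<sqsubseteq> c' \<sqinter> b" by (rule meet_left_mono[OF ec(2)]; fact ab cl)
    have "(e \<sqinter> a) \<squnion> (e \<sqinter> b) \<in> I"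
      by (rule join[OF down[OF c(2) _ ea] down[OF c(4) _ eb]]; rule meet_closed; fact ab cl)
    then have "e \<sqinter> (a \<squnion> b) \<in> I" using meet_join_distrib ab cl by simp
    then show False using lattice_filter_meet[OF x(1) e ab(3)] x(3) by blast
  qed
  \<comment> \<open>Properness holds because \<open>I\<close> is a nonempty part of the carrier that
    \<open>x\<close> avoids.\<close>
  then have "prime_filter L x" using x I unfolding prime_filter_def by blast
  then show ?thesis using that x ex by blast
qed

text \<open>The principal filter of \<open>a\<close> is extended while avoiding the principal ideal
  of \<open>b\<close>.\<close>

lemma prime_filter_separation:
  assumes ab: "a \<in> carrier L" "b \<in> carrier L" "\<not> a \<sqsubseteq> b"
  obtains x where "prime_filter L x" "a \<in> x" "b \<notin> x"
proof -
  let ?I = "{e \<in> carrier L. e \<sqsubseteq> b}"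
  let ?x = "{e \<in> carrier L. a \<sqsubseteq> e}"
  have "lattice_filter L ?x"
    using ab by (auto simp: lattice_filter_def intro: le_trans meet_le le_refl)
  moreover have "?x \<inter> ?I = {}" using ab by (auto dest: le_trans)
  moreover have "?I \<subseteq> carrier L" by blast
  moreover have "?I \<noteq> {}" using ab by blast
  moreover have "e \<in> ?I" if "c \<in> ?I" "e \<in> carrier L" "e \<sqsubseteq> c" for c e
    using that ab by (auto intro: le_trans)
  moreover have "c \<squnion> e \<in> ?I" if "c \<in> ?I" "e \<in> ?I" for c e
    using that ab by (auto intro: join_le)
  ultimately obtain x where "prime_filter L x" "?x \<subseteq> x" "x \<inter> ?I = {}"
    by (rule prime_filter_extension)
  then show ?thesis using that ab by blast
qed

section \<open>Nuclear points are completely prime\<close>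

lemma nuclear_completely_prime:
  assumes y: "prime_filter L y" and nuc: "nuclear L {y}"
  shows "completely_prime_filter L y"
proof -
  note lf = prime_filter_lattice_filter[OF y]
  let ?X = "topspace (esakia_space L)"
  \<comment> \<open>Nuclearity is tested on the clopen set \<open>?X\<close>, the whole
    space.\<close>
  have "clopen_in (esakia_space L) (down_closure L (?X \<inter> {y}))"
    using nuc by (auto simp: nuclear_def clopen_in_def)
  then have "openin (esakia_space L) (down_closure L {y})"
    using y by (simp add: clopen_in_def topspace_esakia_space)
  moreover have "y \<in> down_closure L {y}" using y by (simp add: down_closure_def)
  ultimately obtain c d where cd: "c \<in> carrier L" "d \<in> carrier L" "y \<in> phi L c - phi L d"
      "phi L c - phi L d \<subseteq> down_closure L {y}"
    by (rule openin_esakia_spaceE)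
  have c: "c \<in> y" and d: "d \<notin> y" using cd(3) y by (auto simp: phi_def)
  \<comment> \<open>A prime filter violating this would lie in \<open>phi L c - phi L d\<close>,
    hence below \<open>y\<close>, and yet contain \<open>b\<close>.\<close>
  have le: "c \<sqinter> b \<sqsubseteq> d" if b: "b \<in> carrier L" "b \<notin> y" for b
  proof (rule ccontr)
    assume "\<not> c \<sqinter> b \<sqsubseteq> d"
    then obtain x where x: "prime_filter L x" "c \<sqinter> b \<in> x" "d \<notin> x"
      using prime_filter_separation cd b meet_closed by metis
    then have "c \<in> x" "b \<in> x"
      using filter_meet_iff[OF prime_filter_lattice_filter] cd b by blast+
    then have "x \<in> down_closure L {y}" using x cd(4) by (auto simp: phi_def)
    then show False using \<open>b \<in> x\<close> b by (auto simp: down_closure_def)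
  qed
  have "\<exists>a\<in>A. a \<in> y" if A: "A \<subseteq> carrier L" "\<Squnion>A \<in> y" for A
  proof (rule ccontr)
    assume "\<not> (\<exists>a\<in>A. a \<in> y)"
    then have "\<Squnion>((\<lambda>s. c \<sqinter> s) ` A) \<sqsubseteq> d"
      using A le cd meet_closed by (intro sup_least) (auto simp: Upper_def)
    \<comment> \<open>The frame law turns the separate bounds into a bound on the meet of
      \<open>c\<close> with the whole join; that meet lies in \<open>y\<close>, which would force
      \<open>d\<close> into \<open>y\<close>.\<close>
    then have "c \<sqinter> \<Squnion>A \<sqsubseteq> d" using meet_sup_distrib A cd by simp
    then show False
      using lattice_filter_upward[OF lf lattice_filter_meet[OF lf c A(2)]] cd d by blast
  qed
  then show ?thesis using lf by (simp add: completely_prime_filter_def)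
qed

section \<open>The common set of points and its two topologies\<close>

lemma nuclear_points_eq: "nuclear_points L = {y. completely_prime_filter L y}"
  using nuclear_completely_prime completely_prime_nuclear completely_prime_filter_prime
  by (auto simp: nuclear_points_def)

text \<open>Compactness enters through the maximality clause of \<open>prime_filter_extension\<close>: applied to
  the ideal of all \<open>a\<close> with \<open>\<phi>(a) \<subseteq> U\<close>, it forces the maximal filter to lie in the closed
  complement of \<open>U\<close>.\<close>

lemma open_upset_phi_subset:
  assumes U: "openin (esakia_space L) U" "upset L U" and y: "y \<in> U"
  obtains a where "a \<in> y" "phi L a \<subseteq> U"
proof (rule ccontr)
  assume "\<not> thesis"
  then have no: "\<And>a. a \<in> y \<Longrightarrow> \<not> phi L a \<subseteq> U" using that by blast
  let ?I = "{a \<in> carrier L. phi L a \<subseteq> U}"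
  have py: "prime_filter L y" using U(2) y by (auto simp: upset_def)
  have "y \<inter> ?I = {}" using no by blast
  moreover have "?I \<subseteq> carrier L" by blast
  moreover have "?I \<noteq> {}" using bottom_closed prime_filter_bottom by (auto simp: phi_def)
  moreover have "b \<in> ?I" if "a \<in> ?I" "b \<in> carrier L" "b \<sqsubseteq> a" for a b
  proof -
    have "phi L b \<subseteq> phi L a"
      using that by (auto simp: phi_def prime_filter_def lattice_filter_def)
    then show ?thesis using that by blast
  qed
  moreover have "a \<squnion> b \<in> ?I" if "a \<in> ?I" "b \<in> ?I" for a b
    using that prime_filter_join_iff join_closed by (auto simp: phi_def)
  ultimately obtain x where x: "prime_filter L x" "y \<subseteq> x" "x \<inter> ?I = {}"
      and max: "\<forall>d\<in>carrier L - x. \<exists>c\<in>x. c \<sqinter> d \<in> ?I"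
    by (rule prime_filter_extension[OF prime_filter_lattice_filter[OF py]])
  note lf = prime_filter_lattice_filter[OF x(1)]
  have "x \<in> U" using U(2) y x by (auto simp: upset_def)
  then obtain c d where cd: "c \<in> carrier L" "d \<in> carrier L" "x \<in> phi L c - phi L d"
      "phi L c - phi L d \<subseteq> U"
    by (rule openin_esakia_spaceE[OF U(1)])
  have cx: "c \<in> x" "d \<notin> x" using cd(3) x(1) by (auto simp: phi_def)
  \<comment> \<open>Since \<open>d\<close> is outside \<open>x\<close>, maximality yields an element
    of \<open>x\<close> whose meet with \<open>d\<close> lies in the ideal.\<close>
  obtain c' where c': "c' \<in> x" "c' \<sqinter> d \<in> ?I" using max cd(2) cx(2) by blast
  have c'c: "c' \<in> carrier L" using c' lattice_filter_carrier[OF lf] by blast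
  \<comment> \<open>A prime filter containing \<open>c\<close> and \<open>c'\<close> lies in
    \<open>phi L (c' \<sqinter> d)\<close> if it contains \<open>d\<close>, and in
    \<open>phi L c - phi L d\<close> otherwise; both sets are inside \<open>U\<close>.\<close>
  have "phi L (c \<sqinter> c') \<subseteq> U"
  proof
    fix z assume z: "z \<in> phi L (c \<sqinter> c')"
    then have zp: "prime_filter L z" by (simp add: phi_def)
    note zf = prime_filter_lattice_filter[OF zp]
    have zc: "c \<in> z" "c' \<in> z"
      using z filter_meet_iff[OF zf cd(1) c'c] by (simp_all add: phi_def)
    show "z \<in> U"
    proof (cases "d \<in> z")
      case True
      then have "z \<in> phi L (c' \<sqinter> d)"
        using zp lattice_filter_meet[OF zf zc(2)] by (simp add: phi_def)
      then show ?thesis using c'(2) by blast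
    next
      case False
      then have "z \<in> phi L c - phi L d" using zp zc by (simp add: phi_def)
      then show ?thesis using cd(4) by blast
    qed
  qed
  moreover have "c \<sqinter> c' \<in> x" by (rule lattice_filter_meet[OF lf cx(1) c'(1)])
  ultimately show False using x(3) lattice_filter_carrier[OF lf] by blast
qed

lemma nuclear_point_space_eq: "nuclear_point_space L = pt_space L"
proof -
  have "openin (nuclear_point_space L) V \<longleftrightarrow> openin (pt_space L) V" for V
  proof
    assume "openin (nuclear_point_space L) V"
    then obtain U where U: "openin (esakia_space L) U" "upset L U"
        and V: "V = U \<inter> {y. completely_prime_filter L y}"
      by (auto simp: nuclear_point_space_def openin_subtopology openin_open_upset_topology
          nuclear_points_eq)
    \<comment> \<open>By \<open>open_upset_phi_subset\<close> the sets \<open>phi L a\<close> with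
      \<open>a\<close> in \<open>A\<close> cover \<open>U\<close>, so the join of \<open>A\<close>
      represents the trace of \<open>U\<close> on the completely prime filters.\<close>
    define A where "A = {a \<in> carrier L. phi L a \<subseteq> U}"
    have A: "A \<subseteq> carrier L" by (auto simp: A_def)
    have "y \<in> U \<longleftrightarrow> (\<exists>a\<in>A. a \<in> y)" if y: "completely_prime_filter L y" for y
    proof -
      note py = completely_prime_filter_prime[OF y]
      have "\<exists>a\<in>A. a \<in> y" if "y \<in> U"
        using open_upset_phi_subset[OF U that]
          lattice_filter_carrier[OF prime_filter_lattice_filter[OF py]] A_def by blast
      then show ?thesis using py by (auto simp: A_def phi_def)
    qed
    then have "V = eta L (\<Squnion>A)"
      using completely_prime_filter_sup_iff[OF _ A] by (auto simp: V eta_def)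
    then show "openin (pt_space L) V" using sup_closed[OF A] openin_pt_space by blast
  next
    assume "openin (pt_space L) V"
    then obtain a where a: "a \<in> carrier L" "V = eta L a" using openin_pt_space by blast
    \<comment> \<open>The open upset \<open>phi L a\<close> has trace \<open>eta L a\<close> on the
      nuclear points.\<close>
    have "V = phi L a \<inter> nuclear_points L"
      using completely_prime_filter_prime by (auto simp: a nuclear_points_eq eta_def phi_def)
    moreover have "upset L (phi L a)" by (auto simp: upset_def phi_def)
    ultimately show "openin (nuclear_point_space L) V"
      using phi_open[OF a(1)]
      by (auto simp: nuclear_point_space_def openin_subtopology openin_open_upset_topology)
  qed
  then show ?thesis by (simp add: topology_eq)
qed

end

theorem proposition7p1:
  fixes S :: "'a topology"
  shows "nuclear_point_space (opens_frame S) homeomorphic_space soberification S"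
  unfolding soberification_def frame.nuclear_point_space_eq[OF frame_opens_frame]
  by (rule homeomorphic_space_refl)

end
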